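(* For every integer base $g\ge 2$, the sequence $(s(n))_{n\ge 2}$ is not Benford with respect to natural density in base $g$.
   Context: For a positive integer $n$, $s(n)=\sum_{d\mid n,\ d<n} d=\sigma(n)-n$ is the sum of proper divisors of $n$. A sequence of positive integers $(a_n)_{n\ge 2}$ is Benford in base $g$ with respect to natural density if, for each positive integer $D$, the set of $n\ge2$ for which the base-$g$ expansion of $a_n$ begins with the block of base-$g$ digits of $D$ (i.e. $Dg^{j}\le a_n<(D+1)g^{j}$ for some integer $j\ge 0$) has a natural density, equal to $\log_g(1+1/D)$. The natural density of $A\subseteq\mathbb{N}$ is $\lim_{x\to\infty}\frac1x\#\{n\le x:n\in A\}$, when this limit exists. *)

theory Defs
  imports Complex_Main
begin

definition has_natural_density :: "nat set \<Rightarrow> real \<Rightarrow> bool" where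
  "has_natural_density A \<delta> \<longleftrightarrow>
     ((\<lambda>x::real. real (card {n \<in> A. real n \<le> x}) / x) \<longlongrightarrow> \<delta>) at_top"

definition begins_with_block :: "nat \<Rightarrow> nat \<Rightarrow> nat \<Rightarrow> bool" where
  "begins_with_block g D m \<longleftrightarrow> (\<exists>j::nat. D * g ^ j \<le> m \<and> m < (D + 1) * g ^ j)"

(* Meant for g >= 2 and a sequence indexed by n >= 2 whose terms are positive;
   the values a 0 and a 1 are irrelevant. *)
definition benford_natural_density :: "nat \<Rightarrow> (nat \<Rightarrow> nat) \<Rightarrow> bool" where
  "benford_natural_density g a \<longleftrightarrow>
     (\<forall>D::nat. D \<ge> 1 \<longrightarrow>
        has_natural_density {n. n \<ge> 2 \<and> begins_with_block g D (a n)}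
          (log (real g) (1 + 1 / real D)))"

definition sum_proper_divisors :: "nat \<Rightarrow> nat" where
  "sum_proper_divisors n = (\<Sum>d | d dvd n \<and> d < n. d)"

lemma sum_proper_divisors_pos:
  assumes "n \<ge> 2"
  shows "sum_proper_divisors n > 0"
proof -
  have "finite {d. d dvd n \<and> d < n}" by simp
  moreover have "1 \<in> {d. d dvd n \<and> d < n}" using assms by simp
  ultimately have "1 \<le> (\<Sum>d | d dvd n \<and> d < n. d)"
    by (rule member_le_sum[where f = "\<lambda>d. d", rotated 2]) auto
  then show ?thesis by (simp add: sum_proper_divisors_def)
qed

end

theory Submission
  imports Defs "HOL-Number_Theory.Totient"
begin

text \<open>
  Write $s$ for the sum of proper divisors. For odd $k$ we have $s(2k) = k + 3 s(k)$, and if $k$ has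
  no prime factor up to $z$ then $s(k)/k$ is on average at most $1/z$. So $s(2k)$ stays within a
  relative distance $O(1/z)$ of $k$ for most such $k$. With $D$ of order $z$ and
  $G = g^j$, most of the $k$ without prime factors up to $z$ between $DG$ and $(D + 1/2) G$ therefore
  have $s(2k)$ beginning with the block $D$. Their proportion is of order $\prod_{p \le z} (1 - 1/p)$,
  hence at least of order $z^{-1/2}$, whereas Benford's law allows the block $D$ only
  the proportion $\log_g(1 + 1/D) = O(1/z)$ among the $n$ between $2DG$ and $(2D+1)G$.
\<close>

section \<open>Integers coprime to \<open>Q\<close> in intervals\<close>

lemma card_coprime_period:
  assumes "Q > 0"
  shows "card {k \<in> {a<..a + Q}. coprime k Q} = totient Q"
proof (induction a)
  case 0
  then show ?case by (simp add: totient_def totatives_def conj_commute)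
next
  case (Suc a)
  let ?C = "{k \<in> {Suc a<..a + Q}. coprime k Q}"
  \<comment> \<open>Sliding the window by one trades \<open>a + 1\<close> for
    \<open>a + 1 + Q\<close>, and coprimality to \<open>Q\<close> is \<open>Q\<close>-periodic, so
    the count does not change.\<close>
  have cop: "coprime (Suc (a + Q)) Q \<longleftrightarrow> coprime (Suc a) Q"
    by (metis add_Suc coprime_iff_gcd_eq_1 gcd_add1)
  have "{k \<in> {a<..a + Q}. coprime k Q} = (if coprime (Suc a) Q then insert (Suc a) ?C else ?C)"
    using assms by (auto intro!: Suc_lessI)
  moreover have "{k \<in> {Suc a<..Suc a + Q}. coprime k Q} =
      (if coprime (Suc a) Q then insert (Suc (a + Q)) ?C else ?C)"
    using assms cop by (auto simp: le_Suc_eq)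
  ultimately show ?case using Suc by (auto split: if_splits)
qed

lemma card_coprime_periods:
  assumes "Q > 0"
  shows "card {k \<in> {a<..a + b * Q}. coprime k Q} = b * totient Q"
proof (induction b)
  case (Suc b)
  have "{k \<in> {a<..a + Suc b * Q}. coprime k Q} =
     {k \<in> {a<..a + b * Q}. coprime k Q} \<union> {k \<in> {a + b * Q<..a + b * Q + Q}. coprime k Q}"
    by auto
  also have "card \<dots> = b * totient Q + totient Q"
    using Suc card_coprime_period[OF assms, of "a + b * Q"]
    by (subst card_Un_disjoint) auto
  finally show ?case by simp
qed simp

lemma card_coprime_le:
  assumes "Q > 0"
  shows "card {k \<in> {a<..a + M}. coprime k Q} \<le> (M div Q + 1) * totient Q"
proof -
  have "M \<le> (M div Q + 1) * Q"
    using assms by (metis Suc_eq_plus1 dividend_less_times_div less_imp_le mult.commute mult_Suc_right)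
  then have "{k \<in> {a<..a + M}. coprime k Q} \<subseteq> {k \<in> {a<..a + (M div Q + 1) * Q}. coprime k Q}"
    by auto
  then have "card {k \<in> {a<..a + M}. coprime k Q} \<le> card {k \<in> {a<..a + (M div Q + 1) * Q}. coprime k Q}"
    by (intro card_mono) auto
  also have "\<dots> = (M div Q + 1) * totient Q"
    by (rule card_coprime_periods[OF assms])
  finally show ?thesis .
qed

text \<open>Writing k = e i, the cofactor i is again coprime to \<open>Q\<close> and runs through a
  window of length at most \<open>L div e + 1\<close>. In the term 2, one unit pays for the
  incomplete last period and one for the extra element of this window.\<close>

lemma card_coprime_multiples_le:
  assumes "Q > 0" "e > 0"
  shows "real (card {k \<in> {X<..X + L}. coprime k Q \<and> e dvd k})
    \<le> real (totient Q) * (real L / (real e * real Q) + 2)"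
proof -
  let ?M = "L div e + 1"
  have "card {k \<in> {X<..X + L}. coprime k Q \<and> e dvd k}
      \<le> card {i \<in> {X div e<..X div e + ?M}. coprime i Q}"
  proof (rule card_inj_on_le[where f = "\<lambda>k. k div e"])
    show "inj_on (\<lambda>k. k div e) {k \<in> {X<..X + L}. coprime k Q \<and> e dvd k}"
      using assms by (auto simp: inj_on_def dvd_div_eq_iff)
    show "(\<lambda>k. k div e) ` {k \<in> {X<..X + L}. coprime k Q \<and> e dvd k}
        \<subseteq> {i \<in> {X div e<..X div e + ?M}. coprime i Q}"
    proof clarsimp
      fix k assume k: "X < k" "k \<le> X + L" "coprime k Q" "e dvd k"
      then obtain i where i: "k = e * i" by auto
      have "k div e \<le> (X + L) div e" using k by (simp add: div_le_mono)
      also have "(X + L) div e \<le> X div e + L div e + 1"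
      proof -
        \<comment> \<open>The two remainders add up to less than 2e, so the carry is at most
          1.\<close>
        have "(X mod e + L mod e) div e \<le> 1"
          using assms mod_less_divisor[of e X] mod_less_divisor[of e L]
            less_mult_imp_div_less[of "X mod e + L mod e" 2 e] by linarith
        then show ?thesis using div_add1_eq[of X L e] by linarith
      qed
      finally have 1: "k div e \<le> Suc (X div e + L div e)" by simp
      have 2: "X div e < k div e"
        using k(1) i assms by (simp add: div_less_iff_less_mult mult.commute)
      have 3: "coprime (k div e) Q" using k(3) i assms by simp
      from 1 2 3 show "X div e < k div e \<and> k div e \<le> Suc (X div e + L div e) \<and> coprime (k div e) Q"
        by simp
    qed
  qed auto
  also have "\<dots> \<le> (?M div Q + 1) * totient Q" by (rule card_coprime_le[OF assms(1)])
  finally have "real (card {k \<in> {X<..X + L}. coprime k Q \<and> e dvd k})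
      \<le> real ((?M div Q + 1) * totient Q)"
    by (rule of_nat_mono)
  also have "\<dots> = real (totient Q) * (real (?M div Q) + 1)" by (simp add: algebra_simps)
  also have "real (?M div Q) \<le> real L / (real e * real Q) + 1"
  proof -
    have "real (?M div Q) \<le> real ?M / real Q" by (rule of_nat_div_le_of_nat)
    also have "\<dots> = real (L div e) / real Q + 1 / real Q" by (simp add: add_divide_distrib)
    also have "\<dots> \<le> (real L / real e) / real Q + 1"
      using assms by (intro add_mono divide_right_mono of_nat_div_le_of_nat) auto
    finally show ?thesis by simp
  qed
  finally show ?thesis by (simp add: mult_left_mono add.assoc)
qed

section \<open>Two sums of reciprocals\<close>

lemma sum_inverse_squares_le:
  assumes "z > 0"
  shows "(\<Sum>e\<in>{z<..N}. 1 / (real e)\<^sup>2) \<le> 1 / real z"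
proof (cases "z \<le> N")
  case True
  \<comment> \<open>The bound is sharpened by 1/N so that the induction telescopes.\<close>
  have "(\<Sum>e\<in>{z<..N}. 1 / (real e)\<^sup>2) \<le> 1 / real z - 1 / real N"
    using True
  proof (induction N rule: dec_induct)
    case (step n)
    have n: "n > 0" using step assms by simp
    have "{z<..Suc n} = insert (Suc n) {z<..n}" using step by auto
    moreover have "1 / (real (Suc n))\<^sup>2 \<le> 1 / real n - 1 / real (Suc n)"
    proof -
      have "1 / (real (Suc n))\<^sup>2 \<le> 1 / (real n * real (Suc n))"
        using n by (intro divide_left_mono) (auto simp: power2_eq_square)
      also have "\<dots> = 1 / real n - 1 / real (Suc n)"
        using n by (simp add: field_simps)
      finally show ?thesis .
    qed
    ultimately show ?case using step by simp
  qed simp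
  also have "\<dots> \<le> 1 / real z" by simp
  finally show ?thesis .
qed simp

text \<open>Telescoping with 1/n \<le> 1/sqrt n \<le> 2 (sqrt n - sqrt (n - 1)). The sum enters only
  an error term, where any bound of smaller order than the interval length suffices.\<close>

lemma sum_inverse_le_sqrt:
  "(\<Sum>e\<in>{0<..N}. 1 / real e) \<le> 2 * sqrt (real N)"
proof (induction N)
  case (Suc N)
  have "{0<..Suc N} = insert (Suc N) {0<..N}" by auto
  moreover have "1 / real (Suc N) \<le> 2 * sqrt (real (Suc N)) - 2 * sqrt (real N)"
  proof -
    let ?a = "sqrt (real (Suc N))" and ?b = "sqrt (real N)"
    have a: "?a \<ge> 1" and b: "?b \<ge> 0" and ba: "?b \<le> ?a" by auto
    have s: "(?a - ?b) * (?a + ?b) = 1"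
      by (simp add: algebra_simps)
    have "1 / ?a \<le> 2 * (?a - ?b)"
    proof -
      have "1 \<le> (?a - ?b) * (2 * ?a)"
        using s ba by (smt (verit) mult_left_mono)
      then show ?thesis using a by (simp add: field_simps)
    qed
    moreover have "1 / real (Suc N) \<le> 1 / ?a"
    proof -
      have "1 * ?a \<le> ?a * ?a" using a by (intro mult_right_mono) auto
      then have "?a \<le> real (Suc N)" by (simp only: real_sqrt_mult_self abs_of_nat mult_1)
      then show ?thesis using a by (intro divide_left_mono) auto
    qed
    ultimately show ?thesis by simp
  qed
  ultimately show ?case using Suc by simp
qed simp

section \<open>Sums of proper divisors, on average and at doubled arguments\<close>

lemma sum_proper_divisors_eq_cofactors:
  assumes "k > 0"
  shows "sum_proper_divisors k = (\<Sum>e | e dvd k \<and> 1 < e. k div e)"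
  unfolding sum_proper_divisors_def
proof (rule sum.reindex_bij_witness[where i = "\<lambda>e. k div e" and j = "\<lambda>d. k div d"])
  fix d assume "d \<in> {d. d dvd k \<and> d < k}"
  then show "k div (k div d) = d" "k div (k div d) = d" "k div d \<in> {e. e dvd k \<and> 1 < e}"
    using assms by (auto simp: dvd_def)
next
  fix e assume "e \<in> {e. e dvd k \<and> 1 < e}"
  then show "k div (k div e) = e" "k div e \<in> {d. d dvd k \<and> d < k}"
    using assms by (auto simp: dvd_def)
qed

text \<open>Expand s(k) as the sum of k/e over the divisors e > 1 of k. Such an e inherits
  coprimality to \<open>Q\<close>, so e > z. After exchanging the sums,
  \<open>card_coprime_multiples_le\<close> counts the multiples of e: its main term leads to the sum
  of 1/e^2 over e > z, its term 2 to the harmonic sum.\<close>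

lemma sum_proper_divisors_coprime_le:
  assumes Q: "Q > 0" and z: "z > 0"
    and rough: "\<And>e. coprime e Q \<Longrightarrow> 1 < e \<Longrightarrow> z < e"
  shows "real (\<Sum>k | k \<in> {X<..X + L} \<and> coprime k Q. sum_proper_divisors k)
    \<le> real (X + L) * (real (totient Q) / real Q * real L / real z
                       + 4 * real (totient Q) * sqrt (real (X + L)))"
proof -
  let ?N = "X + L"
  define W where "W = {k. k \<in> {X<..X + L} \<and> coprime k Q}"
  have fW: "finite W" by (simp add: W_def)
  have "(\<Sum>k\<in>W. real (sum_proper_divisors k))
      \<le> (\<Sum>k\<in>W. \<Sum>e | e \<in> {z<..?N} \<and> e dvd k. real ?N / real e)"
  proof (rule sum_mono)
    fix k assume k: "k \<in> W"
    have "real (sum_proper_divisors k) = (\<Sum>e | e dvd k \<and> 1 < e. real (k div e))"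
      using k by (simp add: W_def sum_proper_divisors_eq_cofactors)
    also have "\<dots> \<le> (\<Sum>e | e dvd k \<and> 1 < e. real ?N / real e)"
    proof (rule sum_mono)
      fix e
      have "real (k div e) \<le> real k / real e" by (rule of_nat_div_le_of_nat)
      also have "\<dots> \<le> real ?N / real e"
        using k by (intro divide_right_mono) (auto simp: W_def)
      finally show "real (k div e) \<le> real ?N / real e" .
    qed
    also have "\<dots> \<le> (\<Sum>e | e \<in> {z<..?N} \<and> e dvd k. real ?N / real e)"
    proof (rule sum_mono2)
      show "{e. e dvd k \<and> 1 < e} \<subseteq> {e. e \<in> {z<..?N} \<and> e dvd k}"
      proof clarsimp
        fix e assume e: "e dvd k" "Suc 0 < e"
        have "coprime e Q" using e(1) k unfolding W_def
          by (metis (mono_tags, lifting) coprime_divisors dvd_refl mem_Collect_eq)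
        moreover have "e \<le> k" using e k by (auto simp: W_def intro: dvd_imp_le)
        ultimately show "z < e \<and> e \<le> X + L" using rough e k by (auto simp: W_def)
      qed
    qed auto
    finally show "real (sum_proper_divisors k) \<le> \<dots>" .
  qed
  also have "\<dots> = (\<Sum>e\<in>{z<..?N}. \<Sum>k | k \<in> W \<and> e dvd k. real ?N / real e)"
    using fW by (rule sum.swap_restrict) auto
  also have "\<dots> = (\<Sum>e\<in>{z<..?N}. real ?N / real e * real (card {k. k \<in> W \<and> e dvd k}))"
    by (simp add: mult.commute)
  also have "\<dots> \<le> (\<Sum>e\<in>{z<..?N}. real ?N / real e *
                     (real (totient Q) * (real L / (real e * real Q) + 2)))"
  proof (intro sum_mono mult_left_mono)
    fix e assume e: "e \<in> {z<..?N}"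
    then show "real (card {k. k \<in> W \<and> e dvd k}) \<le> real (totient Q) * (real L / (real e * real Q) + 2)"
      using card_coprime_multiples_le[OF Q, of e X L] by (simp add: W_def conj_assoc)
  qed auto
  also have "\<dots> = real ?N * (real (totient Q) / real Q * real L * (\<Sum>e\<in>{z<..?N}. 1 / (real e)\<^sup>2)
                     + 2 * real (totient Q) * (\<Sum>e\<in>{z<..?N}. 1 / real e))"
    by (simp add: sum_distrib_left sum.distrib[symmetric] power2_eq_square algebra_simps)
  also have "\<dots> \<le> real ?N * (real (totient Q) / real Q * real L * (1 / real z)
                     + 2 * real (totient Q) * (2 * sqrt (real ?N)))"
  proof (intro mult_left_mono add_mono sum_inverse_squares_le z)
    have "(\<Sum>e\<in>{z<..?N}. 1 / real e) \<le> (\<Sum>e\<in>{0<..?N}. 1 / real e)"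
      by (rule sum_mono2) auto
    also note sum_inverse_le_sqrt
    finally show "(\<Sum>e\<in>{z<..?N}. 1 / real e) \<le> 2 * sqrt (real ?N)" .
  qed auto
  also have "2 * real (totient Q) * (2 * sqrt (real ?N)) = 4 * real (totient Q) * sqrt (real ?N)"
    by simp
  finally show ?thesis unfolding W_def by (simp only: of_nat_sum mult_1_right times_divide_eq_right)
qed

lemma sum_divisors_eq:
  assumes "n > 0"
  shows "(\<Sum>d | d dvd n. d) = n + sum_proper_divisors n"
proof -
  have "{d. d dvd n} = insert n {d. d dvd n \<and> d < n}"
    using assms by (auto dest: dvd_imp_le)
  then show ?thesis by (simp add: sum_proper_divisors_def)
qed

text \<open>For odd k the divisors of 2k are those of k and their doubles, so sigma(2k) = 3 sigma(k)
  and s(2k) = 3 (k + s(k)) - 2k.\<close>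

lemma sum_proper_divisors_double:
  assumes "odd k"
  shows "sum_proper_divisors (2 * k) = k + 3 * sum_proper_divisors k"
proof -
  have k: "k > 0" using assms by (auto intro: Nat.gr0I)
  have "{d. d dvd 2 * k} = {d. d dvd k} \<union> (*) 2 ` {d. d dvd k}"
  proof (intro equalityI subsetI)
    fix d assume "d \<in> {d. d dvd 2 * k}"
    then have d: "d dvd 2 * k" by simp
    show "d \<in> {d. d dvd k} \<union> (*) 2 ` {d. d dvd k}"
    proof (cases "even d")
      case True
      then show ?thesis using d by (auto elim!: evenE)
    next
      case False
      then have "coprime d 2" by simp
      then show ?thesis using d by (simp add: coprime_dvd_mult_right_iff)
    qed
  qed auto
  moreover have "{d. d dvd k} \<inter> (*) 2 ` {d. d dvd k} = {}"
    using assms by (auto dest: dvd_mult_left)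
  moreover have "finite {d. d dvd k}" using k by simp
  ultimately have "(\<Sum>d | d dvd 2 * k. d) = (\<Sum>d | d dvd k. d) + (\<Sum>d\<in>(*) 2 ` {d. d dvd k}. d)"
    by (simp add: sum.union_disjoint)
  also have "(\<Sum>d\<in>(*) 2 ` {d. d dvd k}. d) = 2 * (\<Sum>d | d dvd k. d)"
    by (subst sum.reindex) (auto simp: inj_on_def sum_distrib_left)
  finally show ?thesis
    using sum_divisors_eq[of k] sum_divisors_eq[of "2 * k"] k by simp
qed

section \<open>Lower bound for the proportion of integers without small prime factors\<close>

lemma prod_primes_ge:
  "(\<Prod>p | prime p \<and> p \<le> 2 * r + 2. 1 - 1 / real p) \<ge> 1 / (2 * sqrt (2 * real r + 1))"
proof (induction r)
  case 0
  have primes: "{p::nat. prime p \<and> p \<le> 2 * 0 + 2} = {2}"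
    by (auto dest: prime_ge_2_nat)
  show ?case unfolding primes by simp
next
  case (Suc r)
  let ?P = "\<lambda>n. \<Prod>p | prime p \<and> p \<le> n. 1 - 1 / real p"
  let ?q = "2 * r + 3"
  have ev: "\<not> prime (Suc (Suc (Suc (Suc (2 * r)))))"
  proof -
    have "Suc (Suc (Suc (Suc (2 * r)))) = 2 * (r + 2)" by simp
    then show ?thesis using prime_odd_nat[of "2 * (r + 2)"] by force
  qed
  \<comment> \<open>Only 2r + 3 can be a new prime. Its factor 1 - 1/(2r + 3) is charged in either
    case, so the product is compared with one over all odd numbers.\<close>
  have "{p. prime p \<and> p \<le> 2 * Suc r + 2} =
      (if prime ?q then insert ?q {p. prime p \<and> p \<le> 2 * r + 2} else {p. prime p \<and> p \<le> 2 * r + 2})"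
    using ev by (auto simp: le_Suc_eq numeral_eq_Suc)
  moreover have pos: "?P (2 * r + 2) \<ge> 0"
    by (intro prod_nonneg) (auto dest: prime_ge_1_nat)
  ultimately have "?P (2 * Suc r + 2) \<ge> (1 - 1 / real ?q) * ?P (2 * r + 2)"
    by (auto intro: mult_left_le_one_le)
  moreover have "(1 - 1 / real ?q) * ?P (2 * r + 2) \<ge> (1 - 1 / real ?q) * (1 / (2 * sqrt (2 * real r + 1)))"
    using Suc by (intro mult_left_mono) auto
  moreover have "(1 - 1 / real ?q) * (1 / (2 * sqrt (2 * real r + 1))) \<ge> 1 / (2 * sqrt (2 * real (Suc r) + 1))"
  proof -
    define x where "x = real r"
    have x: "x \<ge> 0" by (simp add: x_def)
    \<comment> \<open>The inequality of arithmetic and geometric means; the induction step reduces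
      to it.\<close>
    have "sqrt ((2 * x + 1) * (2 * x + 3)) \<le> 2 * x + 2"
      using x by (intro real_le_lsqrt) (auto simp: power2_eq_square algebra_simps)
    then have "sqrt (2 * x + 1) * (sqrt (2 * x + 3) * sqrt (2 * x + 3)) \<le> (2 * x + 2) * sqrt (2 * x + 3)"
      using mult_right_mono[of "sqrt (2 * x + 1) * sqrt (2 * x + 3)" "2 * x + 2" "sqrt (2 * x + 3)"] x
      by (simp only: real_sqrt_mult mult.assoc real_sqrt_ge_zero)
    then have "sqrt (2 * x + 1) * (2 * x + 3) \<le> (2 * x + 2) * sqrt (2 * x + 3)"
      using x by simp
    then have "1 / (2 * sqrt (2 * x + 3)) \<le> (2 * x + 2) / ((2 * x + 3) * (2 * sqrt (2 * x + 1)))"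
      using x by (simp add: pos_le_divide_eq pos_divide_le_eq mult_ac)
    also have "\<dots> = (1 - 1 / (2 * x + 3)) * (1 / (2 * sqrt (2 * x + 1)))"
      using x by (simp add: diff_divide_eq_iff)
    finally show ?thesis by (simp add: x_def add.commute)
  qed
  ultimately show ?case by linarith
qed

text \<open>A factorial has exactly the primes up to its argument as prime factors, so Euler's
  product formula turns the totient ratio into the product of \<open>prod_primes_ge\<close>.\<close>

lemma totient_fact_ge:
  "real (totient (fact (2 * r + 2))) / fact (2 * r + 2) \<ge> 1 / (2 * sqrt (2 * real r + 1))"
proof -
  have "prime_factors (fact (2 * r + 2) :: nat) = {p. prime p \<and> p \<le> 2 * r + 2}"
    by (auto simp: prime_factors_dvd prime_dvd_fact_iff simp del: fact_Suc)
  then show ?thesis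
    using prod_primes_ge[of r] totient_formula2[of "fact (2 * r + 2)"]
    by (simp del: fact_Suc)
qed

lemma coprime_fact_imp_greater:
  assumes "coprime e (fact n :: nat)" "1 < e"
  shows "n < e"
proof (rule ccontr)
  assume "\<not> n < e"
  then have "e dvd fact n" using assms by (intro dvd_fact) auto
  then show False using assms by (metis coprime_absorb_left dvd_refl nat_dvd_1_iff_1 less_irrefl)
qed

section \<open>Many integers \<open>k\<close> coprime to \<open>Q\<close> with small s(k)\<close>

lemma card_small_sum_proper_divisors_ge:
  fixes Q D G :: nat
  defines "L \<equiv> G div (2 * Q) * Q"
  assumes Q: "Q > 0" and G: "G > 0"
    and rough: "\<And>e. coprime e Q \<Longrightarrow> 1 < e \<Longrightarrow> 12 * (D + 1) < e"
  shows "real (card {k \<in> {D * G<..D * G + L}. coprime k Q \<and> 6 * sum_proper_divisors k < G})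
    \<ge> real (totient Q) / real Q * real L / 2
        - 24 * real (D + 1) * real (totient Q) * sqrt (real ((D + 1) * G))"
proof -
  let ?s = sum_proper_divisors and ?X = "D * G"
  define \<rho> where "\<rho> = real (totient Q) / real Q"
  define S where "S = sqrt (real ((D + 1) * G))"
  define W where "W = {k. k \<in> {?X<..?X + L} \<and> coprime k Q}"
  define A where "A = {k \<in> W. 6 * ?s k < G}"
  define B where "B = {k \<in> W. G \<le> 6 * ?s k}"
  have fin: "finite W" "finite A" "finite B" by (auto simp: W_def A_def B_def)
  have "W = A \<union> B" "A \<inter> B = {}" by (auto simp: A_def B_def)
  then have "card W = card A + card B" using fin by (simp add: card_Un_disjoint)
  \<comment> \<open>\<open>L\<close> is G/2 rounded down to a multiple of \<open>Q\<close>, so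
    \<open>W\<close> fills whole periods and its size is exact.\<close>
  moreover have "card W = G div (2 * Q) * totient Q"
    using card_coprime_periods[OF Q, of ?X "G div (2 * Q)"] by (simp add: W_def L_def)
  ultimately have AB: "real (card A) + real (card B) = \<rho> * real L"
    using Q by (simp add: \<rho>_def L_def field_simps flip: of_nat_add of_nat_mult)
  have "L \<le> G"
  proof -
    have "L * 2 \<le> G" unfolding L_def
      by (metis div_times_less_eq_dividend mult.assoc mult.commute)
    then show ?thesis by simp
  qed
  then have XL: "?X + L \<le> (D + 1) * G" by simp
  \<comment> \<open>Markov's inequality: each element of \<open>B\<close> contributes at least
    \<open>G\<close> to the sum of 6 s(k) over \<open>W\<close>.\<close>
  have "real (card B) * real G = (\<Sum>k\<in>B. real G)" by simp
  also have "\<dots> \<le> (\<Sum>k\<in>B. 6 * real (?s k))"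
    by (intro sum_mono) (auto simp: B_def)
  also have "\<dots> \<le> (\<Sum>k\<in>W. 6 * real (?s k))"
    using fin by (intro sum_mono2) (auto simp: B_def)
  also have "\<dots> = 6 * real (\<Sum>k | k \<in> {?X<..?X + L} \<and> coprime k Q. ?s k)"
    by (simp add: sum_distrib_left W_def)
  \<comment> \<open>The average bound is used with z = 12 (D + 1). As the elements of
    \<open>W\<close> are at most (D + 1) G, its main term becomes G \<rho> L / 2, so up to the error
    term at most half of \<open>W\<close> lies in \<open>B\<close>.\<close>
  also have "\<dots> \<le> 6 * (real (?X + L) * (\<rho> * real L / real (12 * (D + 1))
                 + 4 * real (totient Q) * sqrt (real (?X + L))))"
    unfolding \<rho>_def
    by (intro mult_left_mono sum_proper_divisors_coprime_le Q rough) auto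
  also have "\<dots> \<le> 6 * (real ((D + 1) * G) * (\<rho> * real L / real (12 * (D + 1))
                 + 4 * real (totient Q) * S))"
    unfolding S_def
    by (intro mult_left_mono mult_mono add_mono of_nat_mono XL real_sqrt_le_mono)
       (auto simp: \<rho>_def)
  also have "\<dots> = (\<rho> * real L / 2 + 24 * real (D + 1) * real (totient Q) * S) * real G"
    by (simp add: field_simps)
  finally have "real (card B) \<le> \<rho> * real L / 2 + 24 * real (D + 1) * real (totient Q) * S"
    using G by (simp add: mult_le_cancel_right)
  then have "real (card A) \<ge> \<rho> * real L / 2 - 24 * real (D + 1) * real (totient Q) * S"
    using AB by simp
  moreover have "A = {k \<in> {?X<..?X + L}. coprime k Q \<and> 6 * ?s k < G}"
    by (auto simp: A_def W_def)
  ultimately show ?thesis by (simp only: \<rho>_def S_def)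
qed

section \<open>Leading digits, density and the contradiction\<close>

lemma begins_with_block_sum_proper_divisors_double:
  assumes "odd k" "D * g ^ j \<le> k" "2 * k \<le> (2 * D + 1) * g ^ j" "6 * sum_proper_divisors k < g ^ j"
  shows "begins_with_block g D (sum_proper_divisors (2 * k))"
  unfolding begins_with_block_def
proof (intro exI conjI)
  show "D * g ^ j \<le> sum_proper_divisors (2 * k)"
    using assms by (simp add: sum_proper_divisors_double)
  \<comment> \<open>The value is k + 3 s(k), with k at most (D + 1/2) g^j and 3 s(k) below g^j /
    2.\<close>
  show "sum_proper_divisors (2 * k) < (D + 1) * g ^ j"
    using assms(2-4) unfolding sum_proper_divisors_double[OF assms(1)] by (simp add: algebra_simps)
qed

text \<open>The density limit is taken along x = c G(j) and multiplied by c. With one common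
  normalisation G(j), counts for different c can be subtracted, which gives the count in a
  window.\<close>

lemma has_natural_density_subsequence:
  assumes "has_natural_density A \<delta>" "c > 0" "filterlim G at_top sequentially"
  shows "(\<lambda>j. real (card {n \<in> A. n \<le> c * G j}) / real (G j)) \<longlonglongrightarrow> real c * \<delta>"
proof -
  have G: "filterlim (\<lambda>j. real (G j)) at_top sequentially"
    by (rule filterlim_compose[OF filterlim_real_sequentially assms(3)])
  have "filterlim (\<lambda>j. real c * real (G j)) at_top sequentially"
    using assms(2) by (intro filterlim_tendsto_pos_mult_at_top[OF tendsto_const _ G]) auto
  from filterlim_compose[OF assms(1)[unfolded has_natural_density_def] this]
  have "(\<lambda>j. real (card {n \<in> A. n \<le> c * G j}) / (real c * real (G j))) \<longlonglongrightarrow> \<delta>"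
    by (simp flip: of_nat_mult)
  from tendsto_mult[OF tendsto_const[of "real c"] this] show ?thesis
    using assms(2) by simp
qed

lemma log_one_plus_inverse_le:
  assumes "g \<ge> 2" "D > 0"
  shows "log (real g) (1 + 1 / real D) \<le> 2 / real D"
proof -
  have "ln (real g) \<ge> ln 2" using assms by simp
  \<comment> \<open>This amounts to exp(1/2) \<le> 2.\<close>
  moreover have "ln (2::real) \<ge> 1 / 2"
    using ln_ge_iff[of 2 "1/2"] exp_bound_half[of "1/2::real"] by simp
  ultimately have "ln (real g) \<ge> 1 / 2" by linarith
  moreover have "ln (1 + 1 / real D) \<le> 1 / real D"
    by (rule ln_add_one_self_le_self) simp
  ultimately have "ln (1 + 1 / real D) / ln (real g) \<le> (1 / real D) / (1 / 2)"
    by (intro frac_le) auto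
  then show ?thesis by (simp add: log_def)
qed

theorem proposition3p6:
  fixes g :: nat
  assumes "g \<ge> 2"
  shows "\<not> benford_natural_density g sum_proper_divisors"
proof
  assume benford: "benford_natural_density g sum_proper_divisors"
  \<comment> \<open>Any $D$ with $D > 16 \sqrt{12 D + 13}$ works: $\rho/4$, with $\rho \ge 1/(2\sqrt{2r+1})$,
    has to exceed the bound $2/D$ for the density of the block.\<close>
  define D :: nat where "D = 10000"
  have D_pos: "D \<ge> 1" by (simp add: D_def)
  \<comment> \<open>Then 2r + 2 exceeds 12 (D + 1), the roughness that
    \<open>card_small_sum_proper_divisors_ge\<close> asks for.\<close>
  define r where "r = 6 * (D + 1)"
  define Q :: nat where "Q = fact (2 * r + 2)"
  define \<rho> where "\<rho> = real (totient Q) / real Q"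
  define C where "C = 24 * real (D + 1) * real (totient Q) * sqrt (real (D + 1))"
  define A where "A = {n. n \<ge> 2 \<and> begins_with_block g D (sum_proper_divisors n)}"
  define N where "N = (\<lambda>c j. card {n \<in> A. n \<le> c * g ^ j})"
  have Q: "Q > 0" by (simp add: Q_def)
  have "even Q" unfolding Q_def by (intro dvd_fact) auto
  have rough: "12 * (D + 1) < e" if "coprime e Q" "1 < e" for e
    using coprime_fact_imp_greater[of e "2 * r + 2"] that by (simp add: Q_def r_def del: fact_Suc)
  have "has_natural_density A (log (real g) (1 + 1 / real D))"
    using benford unfolding benford_natural_density_def A_def using D_pos by blast
  moreover have g: "filterlim (\<lambda>j. g ^ j) at_top sequentially"
    using assms by (intro filterlim_subseq strict_monoI power_strict_increasing) auto
  ultimately have N: "(\<lambda>j. real (N c j) / real (g ^ j)) \<longlonglongrightarrow> real c * log (real g) (1 + 1 / real D)"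
    if "c > 0" for c
    using has_natural_density_subsequence[of A _ c "\<lambda>j. g ^ j"] that by (simp add: N_def)
  \<comment> \<open>Under Benford's law the window from 2D g^j to (2D + 1) g^j, of length g^j,
    contains a proportion of \<open>A\<close> tending to the density of \<open>A\<close>.\<close>
  have "(\<lambda>j. real (N (2 * D + 1) j) / real (g ^ j) - real (N (2 * D) j) / real (g ^ j))
     \<longlonglongrightarrow> real (2 * D + 1) * log (real g) (1 + 1 / real D) - real (2 * D) * log (real g) (1 + 1 / real D)"
    by (intro tendsto_diff N) (auto simp: D_def)
  then have upper: "(\<lambda>j. (real (N (2 * D + 1) j) - real (N (2 * D) j)) / real (g ^ j))
      \<longlonglongrightarrow> log (real g) (1 + 1 / real D)"
    by (simp add: diff_divide_distrib algebra_simps)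
  \<comment> \<open>The same window contains the doubles of the good k. The term \<rho>/4 is \<rho>
    L / 2 at L = G/2, divided by G; the second term is the loss from rounding \<open>L\<close>, the
    third the error term.\<close>
  have bound: "\<rho> / 4 - \<rho> * real Q / 2 / real (g ^ j) - C / sqrt (real (g ^ j))
      \<le> (real (N (2 * D + 1) j) - real (N (2 * D) j)) / real (g ^ j)" for j
  proof -
    define G where "G = g ^ j"
    define L where "L = G div (2 * Q) * Q"
    define K where "K = {k \<in> {D * G<..D * G + L}. coprime k Q \<and> 6 * sum_proper_divisors k < G}"
    have G: "G > 0" using assms by (simp add: G_def)
    have L1: "2 * L \<le> G" unfolding L_def
      by (metis div_times_less_eq_dividend mult.assoc mult.commute)
    have "G < (G div (2 * Q) + 1) * (2 * Q)"
      using Q by (simp add: dividend_less_div_times)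
    then have "G < 2 * L + 2 * Q" by (simp add: L_def algebra_simps)
    then have "real G \<le> real (2 * L + 2 * Q)" by (simp only: of_nat_le_iff less_imp_le)
    then have "real G / 2 - real Q \<le> real L" by simp
    then have "\<rho> * (real G / 2 - real Q) / 2 \<le> \<rho> * real L / 2"
      by (intro divide_right_mono mult_left_mono) (auto simp: \<rho>_def)
    moreover have "\<rho> * real L / 2 - C * sqrt (real G) \<le> real (card K)"
      using card_small_sum_proper_divisors_ge[OF Q G rough]
      unfolding K_def L_def \<rho>_def C_def by (simp only: of_nat_mult real_sqrt_mult mult.assoc)
    moreover have "card K + N (2 * D) j \<le> N (2 * D + 1) j"
    proof -
      \<comment> \<open>The doubles lie above 2DG, hence are disjoint from the elements of
        \<open>A\<close> up to 2DG, and 2L \<le> G keeps them at or below (2D + 1) G. They are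
        doubles of odd numbers because \<open>Q\<close> is even.\<close>
      have sub: "(*) 2 ` K \<union> {n \<in> A. n \<le> 2 * D * G} \<subseteq> {n \<in> A. n \<le> (2 * D + 1) * G}"
      proof (intro Un_least image_subsetI)
        fix k assume k: "k \<in> K"
        have "odd k"
        proof
          assume "even k"
          then have "is_unit (2::nat)"
            using k \<open>even Q\<close> by (intro coprime_common_divisor[of k Q]) (auto simp: K_def)
          then show False by simp
        qed
        moreover have "2 * k \<le> (2 * D + 1) * G" "D * G \<le> k" "k > 0"
          using k L1 by (auto simp: K_def algebra_simps)
        ultimately show "2 * k \<in> {n \<in> A. n \<le> (2 * D + 1) * G}"
          using k begins_with_block_sum_proper_divisors_double[of k D g j]
          by (simp add: A_def K_def G_def)
      qed auto
      have "card K + N (2 * D) j = card ((*) 2 ` K) + card {n \<in> A. n \<le> 2 * D * G}"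
        by (simp add: card_image inj_on_def N_def G_def)
      also have "\<dots> = card ((*) 2 ` K \<union> {n \<in> A. n \<le> 2 * D * G})"
        by (intro card_Un_disjoint[symmetric]) (auto simp: K_def)
      also have "\<dots> \<le> card {n \<in> A. n \<le> (2 * D + 1) * G}"
        by (intro card_mono sub) auto
      finally show ?thesis by (simp only: N_def G_def)
    qed
    ultimately have "\<rho> * (real G / 2 - real Q) / 2 - C * sqrt (real G)
        \<le> real (N (2 * D + 1) j) - real (N (2 * D) j)"
      by linarith
    then have "(\<rho> * (real G / 2 - real Q) / 2 - C * sqrt (real G)) / real G
        \<le> (real (N (2 * D + 1) j) - real (N (2 * D) j)) / real G"
      by (rule divide_right_mono) simp
    moreover have "sqrt (real G) / real G = 1 / sqrt (real G)"
      using G by (simp add: field_simps)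
    then have "(\<rho> * (real G / 2 - real Q) / 2 - C * sqrt (real G)) / real G
        = \<rho> / 4 - \<rho> * real Q / 2 / real G - C / sqrt (real G)"
      using G by (simp add: field_simps)
    ultimately show ?thesis by (simp only: G_def)
  qed
  have gr: "filterlim (\<lambda>j. real (g ^ j)) at_top sequentially"
    by (rule filterlim_compose[OF filterlim_real_sequentially g])
  \<comment> \<open>\<open>Q\<close>, \<rho> and \<open>C\<close> do not depend on j, so both error
    terms vanish in the limit.\<close>
  have "(\<lambda>j. \<rho> / 4 - \<rho> * real Q / 2 / real (g ^ j) - C / sqrt (real (g ^ j))) \<longlonglongrightarrow> \<rho> / 4 - 0 - 0"
    by (intro tendsto_diff tendsto_const real_tendsto_divide_at_top[OF tendsto_const]
          gr filterlim_compose[OF sqrt_at_top gr])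
  from LIMSEQ_le[OF this upper] have "\<rho> / 4 \<le> log (real g) (1 + 1 / real D)"
    using bound by simp
  also have "\<dots> \<le> 2 / real D"
    using assms by (intro log_one_plus_inverse_le) (auto simp: D_def)
  finally have "\<rho> \<le> 8 / 10000" by (simp add: D_def)
  moreover have "\<rho> \<ge> 1 / (2 * sqrt (2 * real r + 1))"
    unfolding \<rho>_def Q_def using totient_fact_ge[of r] by (simp del: fact_Suc)
  \<comment> \<open>Here 2r + 1 = 120013 is below 400^2 = 160000, so \<rho> is at least 1/800, which
    exceeds 8/10000.\<close>
  moreover have "sqrt (2 * real r + 1) \<le> 400"
    by (intro real_le_lsqrt) (auto simp: r_def D_def)
  then have "1 / (2 * sqrt (2 * real r + 1)) \<ge> 1 / 800"
    by (intro divide_left_mono) (auto simp: r_def D_def)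
  ultimately show False by linarith
qed

end
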